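(* Let $K\ge2$ be an integer. For each integer $j\ge2$ let $(\nu^j_k)_{k\in\mathbb{Z}}$ be real numbers with $\nu^j_k\ge0$, $\nu^j_k=\nu^j_{k+2^j}$, $|\nu^j_k|^2+|\nu^j_{k+2^{j-1}}|^2=1$, $\nu^j_k=\nu^j_{-k}$ for all $k\in\mathbb{Z}$, and $\nu^j_0=1$. Put $\theta^j_k:=\arccos\nu^j_k$. Let $z^K_j$ be a uniform spline of order $K+1$ of minimal defect on $[0,1/4]$ such that $z^K_j(k2^{-j})=\theta^j_k$ for $k=0,\dots,2^{j-2}$ and $(z^K_j)^{(l)}(0)=0$ for $l=1,\dots,K-1$, and let $m^K_j$ be the even $1$-periodic function with $$m^K_j(\xi)=\begin{cases}\cos(z^K_j(\xi)),&\xi\in[0,1/4],\\ \sin(z^K_j(1/2-\xi)),&\xi\in(1/4,1/2].\end{cases}$$ If $$\sum_j\frac1{2^j}\left(\int_0^{1/4}\big((z^K_j)'(\xi)\big)^4+\big((z^K_j)''(\xi)\big)^2\,d\xi\right)^{1/2}<\infty,$$ then for each $j\ge 1$ the infinite product $\widehat{\varphi_j}(\xi)=\prod_{r=1}^\infty m^K_{j+r}(\xi/2^r)$ converges uniformly and absolutely on every $[a,b]\subset\mathbb{R}$, $\widehat{\varphi_j}\in L_2(\mathbb{R})$, and $\|\widehat{\varphi_j}\|_2\le1$.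
   Context: A uniform spline of order $K+1$ of minimal defect on $[0,1/4]$ (here with the knots $k2^{-j}$, $k=0,\dots,2^{j-2}$) is a function in $C^{K-1}[0,1/4]$ whose restriction to each interval $[k2^{-j},(k+1)2^{-j}]$, $k=0,\dots,2^{j-2}-1$, is a polynomial of degree at most $K$. $\|\cdot\|_2$ is the $L_2(\mathbb{R})$ norm. Absolute convergence of $\prod_r p_r$ means convergence of $\sum_r|p_r-1|$. *)

theory Defs
  imports "HOL-Analysis.Analysis" "HOL-Computational_Algebra.Polynomial"
begin

text \<open>The derivative is taken within \<open>S\<close>, so that on a closed interval it is one-sided at the
  endpoints and independent of the values outside the interval. Where the derivative does not exist
  the value is unspecified.\<close>

definition nderiv_within :: "real set \<Rightarrow> nat \<Rightarrow> (real \<Rightarrow> real) \<Rightarrow> real \<Rightarrow> real" where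
  "nderiv_within S n f = ((\<lambda>g x. vector_derivative g (at x within S)) ^^ n) f"

definition Ck_on :: "nat \<Rightarrow> real set \<Rightarrow> (real \<Rightarrow> real) \<Rightarrow> bool" where
  "Ck_on n S f \<longleftrightarrow>
     (\<forall>l<n. nderiv_within S l f differentiable_on S) \<and> continuous_on S (nderiv_within S n f)"

text \<open>Splines of order \<open>K + 1\<close> of minimal defect on \<open>[0, 1/4]\<close> with the knots \<open>k / 2 ^ j\<close> for
  \<open>k = 0, \<dots>, 2 ^ (j - 2)\<close>; meant for \<open>K \<ge> 1\<close> and \<open>j \<ge> 2\<close>, because of the truncated subtractions.\<close>

definition uniform_spline :: "nat \<Rightarrow> nat \<Rightarrow> (real \<Rightarrow> real) \<Rightarrow> bool" where
  "uniform_spline K j z \<longleftrightarrow>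
     Ck_on (K - 1) {0..1/4} z \<and>
     (\<forall>k<2 ^ (j - 2). \<exists>p :: real poly. degree p \<le> K \<and>
        (\<forall>x\<in>{real k / 2 ^ j..real (k + 1) / 2 ^ j}. z x = poly p x))"

definition square_integrable :: "(real \<Rightarrow> real) \<Rightarrow> bool" where
  "square_integrable f \<longleftrightarrow> f \<in> borel_measurable lborel \<and> integrable lborel (\<lambda>x. (f x)\<^sup>2)"

definition L2_norm :: "(real \<Rightarrow> real) \<Rightarrow> real" where
  "L2_norm f = sqrt (\<integral>x. (f x)\<^sup>2 \<partial>lborel)"

end

theory Submission
  imports Defs
begin

text \<open>Write \<open>f = cos \<circ> z\<^sub>j\<close> and \<open>E\<^sub>j\<close> for the integral in the hypothesis. Since \<open>z\<^sub>j 0 = 0\<close>, we have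
  \<open>f 0 = 1\<close> and \<open>f' 0 = 0\<close>, and \<open>\<bar>f''\<bar> \<le> \<bar>z\<^sub>j''\<bar> + (z\<^sub>j')\<^sup>2\<close> off the knots; integrating twice and using
  \<open>2u \<le> u\<^sup>2/s + s\<close> gives \<open>\<bar>m\<^sub>j \<xi> - 1\<bar> \<le> const \<cdot> (1 + sqrt E\<^sub>j) \<bar>\<xi>\<bar>\<close>. At \<open>\<xi> / 2\<^sup>r\<close> this is summable in \<open>r\<close>,
  locally uniformly in \<open>\<xi>\<close>, and the product converges because all factors are bounded by 1.
  For the norm, \<open>m\<^sub>j(\<xi>)\<^sup>2 + m\<^sub>j(\<xi> + 1/2)\<^sup>2 = 1\<close> makes the integral of the squared \<open>N\<close>-th partial product
  over any interval of length \<open>2\<^sup>N\<close> independent of \<open>N\<close>, hence equal to 1, and Fatou's lemma applies to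
  the intervals centred at 0.\<close>

section \<open>Deviation of the cosine of an angle function from 1\<close>

text \<open>The points of \<open>S\<close> will be knots, where \<open>d2\<close> may be an unspecified value.\<close>

lemma cos_deviation_bound:
  fixes z d1 d2 :: "real \<Rightarrow> real"
  assumes S: "finite S" and z0: "z 0 = 0"
    and z: "\<And>t. t \<in> {0..a} \<Longrightarrow> (z has_real_derivative d1 t) (at t within {0..a})"
    and d1: "continuous_on {0..a} d1"
    and d2: "\<And>t. t \<in> {0<..<a} - S \<Longrightarrow> (d1 has_real_derivative d2 t) (at t)"
    and int: "(\<lambda>t. d1 t ^ 4 + (d2 t)\<^sup>2) integrable_on {0..a}"
    and s: "s > 0" and x: "x \<in> {0..a}"
  shows "\<bar>cos (z x) - 1\<bar> \<le> (integral {0..a} (\<lambda>t. d1 t ^ 4 + (d2 t)\<^sup>2) / s + 2 * a * s) / 2 * x"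
proof -
  define h where "h = (\<lambda>t. d1 t ^ 4 + (d2 t)\<^sup>2)"
  \<comment> \<open>\<open>B\<close> will be the integral of \<open>H\<close> over
    \<open>{0..a}\<close>. The functions \<open>g\<close> and, off \<open>S\<close>,
    \<open>g'\<close> are the first two derivatives of \<open>cos (z t)\<close>, and
    \<open>H\<close> is the AM-GM majorant of \<open>g'\<close>; the two copies of \<open>s\<close>
    in it come from the two terms of \<open>h\<close>.\<close>
  define B where "B = (integral {0..a} h / s + 2 * a * s) / 2"
  define g where "g = (\<lambda>t. - sin (z t) * d1 t)"
  define g' where "g' = (\<lambda>t. - sin (z t) * d2 t - cos (z t) * (d1 t)\<^sup>2)"
  define H where "H = (\<lambda>t. (h t / s + 2 * s) / 2)"
  have a: "0 \<le> a" using x by auto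
  have cont_z: "continuous_on {0..a} z"
    using z DERIV_continuous_on by blast
  have z_at: "(z has_real_derivative d1 t) (at t)" if "t \<in> {0<..<a}" for t
    using z[of t] that at_within_interior[of t "{0..a}"] by auto
  have h: "h integrable_on {0..a}" using int by (simp add: h_def)
  have H: "(H has_integral B) {0..a}"
  proof -
    have "((\<lambda>t. (1 / (2 * s)) * h t + s) has_integral (1 / (2 * s)) * integral {0..a} h + a * s) {0..a}"
      using has_integral_add[OF has_integral_mult_right[OF integrable_integral[OF h], of "1 / (2 * s)"]
          has_integral_const_real[of s 0 a]] a by simp
    moreover have "H = (\<lambda>t. (1 / (2 * s)) * h t + s)"
      using s by (auto simp: H_def field_simps)
    moreover have "B = (1 / (2 * s)) * integral {0..a} h + a * s"
      using s by (auto simp: B_def field_simps)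
    ultimately show ?thesis by simp
  qed
  have H_nonneg: "0 \<le> H t" for t
    using s by (auto simp: H_def h_def)
  have amgm: "u \<le> (u\<^sup>2 / s + s) / 2" for u
  proof -
    have "0 \<le> (u - s)\<^sup>2 / s" using s by simp
    also have "(u - s)\<^sup>2 / s = u\<^sup>2 / s + s - 2 * u"
      using s by (simp add: power2_eq_square field_simps)
    finally show ?thesis by simp
  qed
  have g'_le: "\<bar>g' t\<bar> \<le> H t" for t
  proof -
    have "\<bar>g' t\<bar> \<le> \<bar>sin (z t)\<bar> * \<bar>d2 t\<bar> + \<bar>cos (z t)\<bar> * (d1 t)\<^sup>2"
      unfolding g'_def by (rule order_trans[OF abs_triangle_ineq4]) (simp add: abs_mult)
    also have "\<dots> \<le> \<bar>d2 t\<bar> + (d1 t)\<^sup>2"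
      by (intro add_mono mult_left_le_one_le) auto
    \<comment> \<open>AM-GM with \<open>u\<close> equal to the absolute value of \<open>d2 t\<close>
      and to \<open>(d1 t)\<^sup>2\<close>, whose squares are exactly the two terms of
      \<open>h\<close>.\<close>
    also have "\<dots> \<le> (\<bar>d2 t\<bar>\<^sup>2 / s + s) / 2 + (((d1 t)\<^sup>2)\<^sup>2 / s + s) / 2"
      by (intro add_mono amgm)
    also have "\<dots> = H t"
      by (simp add: H_def h_def add_divide_distrib power_mult[symmetric])
    finally show ?thesis .
  qed
  have g_le: "\<bar>g t\<bar> \<le> B" if t: "t \<in> {0..a}" for t
  proof -
    have sub: "{0..t} \<subseteq> {0..a}" using t by auto
    \<comment> \<open>The fundamental theorem of calculus tolerates the finite set \<open>S\<close>,
      since \<open>g\<close> is continuous across it. As \<open>z 0 = 0\<close>, the value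
      \<open>g 0\<close> vanishes.\<close>
    have "(g' has_integral (g t - g 0)) {0..t}"
    proof (rule fundamental_theorem_of_calculus_interior_strong[OF S])
      show "(g has_vector_derivative g' u) (at u)" if "u \<in> {0<..<t} - S" for u
        unfolding g_def g'_def has_real_derivative_iff_has_vector_derivative[symmetric]
        using that t by (auto intro!: derivative_eq_intros z_at d2 simp: power2_eq_square)
      show "continuous_on {0..t} g"
        unfolding g_def using continuous_on_subset[OF cont_z sub] continuous_on_subset[OF d1 sub]
        by (intro continuous_intros)
    qed (use t in auto)
    then have g': "g' integrable_on {0..t}" "g t = integral {0..t} g'"
      by (auto simp: has_integral_iff g_def z0)
    have Ht: "H integrable_on {0..t}"
      using H integrable_on_subinterval[OF _ sub] by blast
    have "norm (integral {0..t} g') \<le> integral {0..t} H"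
      by (rule integral_norm_bound_integral[OF g'(1) Ht]) (simp add: g'_le)
    also have "\<dots> \<le> integral {0..a} H"
      by (rule integral_subset_le) (use sub H Ht H_nonneg in auto)
    also have "\<dots> = B" using H by (rule integral_unique)
    finally show ?thesis using g' by simp
  qed
  have "norm (cos (z x) - cos (z 0)) \<le> B * norm (x - 0)"
  proof (rule field_differentiable_bound[where S = "{0..a}" and f' = g])
    show "((\<lambda>t. cos (z t)) has_real_derivative g t) (at t within {0..a})" if "t \<in> {0..a}" for t
      unfolding g_def using that by (auto intro!: derivative_eq_intros z)
  qed (use x a g_le in auto)
  then show ?thesis using x by (simp add: z0 B_def h_def)
qed

section \<open>Derivatives and energy of splines\<close>

text \<open>For \<open>K = 2\<close> a spline is only guaranteed to be continuously differentiable,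
  so the second derivative is controlled only between knots, where the spline agrees with a
  polynomial. This suffices for the energy integral, which ignores finitely many points.\<close>

lemma uniform_spline_derivatives:
  assumes K: "K \<ge> 2" and j: "j \<ge> 2" and spl: "uniform_spline K j z"
  defines "d1 \<equiv> nderiv_within {0..1/4} 1 z"
    and "d2 \<equiv> nderiv_within {0..1/4} 2 z"
  shows uniform_spline_has_derivative:
      "\<And>x. x \<in> {0..1/4} \<Longrightarrow> (z has_real_derivative d1 x) (at x within {0..1/4})"
    and uniform_spline_continuous_derivative: "continuous_on {0..1/4} d1"
    and uniform_spline_second_derivative:
      "\<And>x. x \<in> {0<..<1/4} - (\<lambda>k. real k / 2 ^ j) ` {..2 ^ (j - 2)} \<Longrightarrow>
        (d1 has_real_derivative d2 x) (at x)"
    and uniform_spline_energy_integrable: "(\<lambda>x. d1 x ^ 4 + (d2 x)\<^sup>2) integrable_on {0..1/4}"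
proof -
  have d1: "d1 = (\<lambda>x. vector_derivative z (at x within {0..1/4}))"
    by (simp add: d1_def nderiv_within_def)
  have d2: "d2 = (\<lambda>x. vector_derivative d1 (at x within {0..1/4}))"
    by (simp add: d2_def d1 nderiv_within_def numeral_2_eq_2)
  have Ck: "Ck_on (K - 1) {0..1/4} z"
    using spl by (simp add: uniform_spline_def)
  then have "nderiv_within {0..1/4} 0 z differentiable_on {0..1/4}"
    using K unfolding Ck_on_def by auto
  then have zd: "z differentiable_on {0..1/4}" by (simp add: nderiv_within_def)
  show "(z has_real_derivative d1 x) (at x within {0..1/4})" if "x \<in> {0..1/4}" for x
    using zd that
    unfolding d1 has_real_derivative_iff_has_vector_derivative vector_derivative_works[symmetric]
    by (simp add: differentiable_on_def)
  \<comment> \<open>For \<open>K = 2\<close> the first derivative is the top one in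
    \<open>Ck_on (K - 1)\<close> and is continuous by definition; for larger \<open>K\<close> it is
    even differentiable.\<close>
  show "continuous_on {0..1/4} d1"
  proof (cases "K = 2")
    case True
    then show ?thesis using Ck by (simp add: Ck_on_def d1_def)
  next
    case False
    then have "d1 differentiable_on {0..1/4}"
      using Ck K unfolding Ck_on_def d1_def by auto
    then show ?thesis by (rule differentiable_imp_continuous_on)
  qed
  have pow: "(2::real) ^ j = 2 ^ (j - 2) * 4"
    using j by (metis le_add_diff_inverse2 power2_eq_square power_add mult_2 numeral_Bit0)
  have knot_le: "real k / 2 ^ j \<le> 1/4" if "k \<le> 2 ^ (j - 2)" for k
  proof -
    have "real k \<le> real (2 ^ (j - 2))" using that by (simp only: of_nat_le_iff)
    then show ?thesis using pow by (simp add: field_simps)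
  qed
  have piece: "\<exists>p :: real poly. \<forall>x\<in>{real k / 2 ^ j<..<real (k + 1) / 2 ^ j}.
      d1 x = poly (pderiv p) x \<and> d2 x = poly (pderiv (pderiv p)) x \<and>
      (d1 has_real_derivative d2 x) (at x)"
    if k: "k < 2 ^ (j - 2)" for k
  proof -
    let ?I = "{real k / 2 ^ j<..<real (k + 1) / 2 ^ j}"
    have I: "x \<in> {0<..<1/4}" if "x \<in> ?I" for x
    proof -
      have "0 \<le> real k / 2 ^ j" "real (k + 1) / 2 ^ j \<le> 1/4"
        using knot_le[of "k + 1"] k by (simp, auto simp del: of_nat_add)
      then show ?thesis using that unfolding greaterThanLessThan_iff by linarith
    qed
    obtain p :: "real poly" where p: "z x = poly p x" if "x \<in> ?I" for x
      using spl k unfolding uniform_spline_def by fastforce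
    \<comment> \<open>The open piece lies inside \<open>{0<..<1/4}\<close>, so the derivative within
      the closed interval is the ordinary one there.\<close>
    have vd: "vector_derivative f (at x within {0..1/4}) = f'"
      if "(f has_real_derivative f') (at x)" "x \<in> ?I" for f :: "real \<Rightarrow> real" and f' x
      using that I[of x]
      by (intro vector_derivative_at_within_ivl) (auto simp: has_real_derivative_iff_has_vector_derivative)
    have z': "d1 x = poly (pderiv p) x" if "x \<in> ?I" for x
    proof -
      have "(z has_real_derivative poly (pderiv p) x) (at x)"
        by (rule has_field_derivative_transform_within_open[OF poly_DERIV, of ?I])
          (use that p in auto)
      then show ?thesis using vd that by (simp add: d1)
    qed
    have z'': "(d1 has_real_derivative poly (pderiv (pderiv p)) x) (at x)" if "x \<in> ?I" for x
      by (rule has_field_derivative_transform_within_open[OF poly_DERIV, of ?I])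
        (use that z' in auto)
    then have "d2 x = poly (pderiv (pderiv p)) x" if "x \<in> ?I" for x
      using vd that by (simp add: d2)
    with z' z'' show ?thesis by (intro exI[of _ p]) auto
  qed
  show "(d1 has_real_derivative d2 x) (at x)"
    if x: "x \<in> {0<..<1/4} - (\<lambda>k. real k / 2 ^ j) ` {..2 ^ (j - 2)}" for x
  proof -
    \<comment> \<open>The index of the piece containing \<open>x\<close>; the left inequality
      becomes strict because \<open>x\<close> is not a knot.\<close>
    define k where "k = nat \<lfloor>x * 2 ^ j\<rfloor>"
    have k1: "real k \<le> x * 2 ^ j" "x * 2 ^ j < real k + 1"
      using x unfolding k_def by (auto simp: nat_less_iff)
    have "x * 2 ^ j = (x * 4) * 2 ^ (j - 2)" using pow by simp
    also have "\<dots> < 1 * 2 ^ (j - 2)" using x by (intro mult_strict_right_mono) auto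
    finally have "real k < 2 ^ (j - 2)" using k1(1) by linarith
    then have k: "k < 2 ^ (j - 2)" by simp
    then have "x \<noteq> real k / 2 ^ j" using x by auto
    then have "x \<in> {real k / 2 ^ j<..<real (k + 1) / 2 ^ j}"
      using k1 by (auto simp: field_simps)
    then show ?thesis using piece[OF k] by blast
  qed
  have "(\<lambda>x. d1 x ^ 4 + (d2 x)\<^sup>2) integrable_on {0..real k / 2 ^ j}" if "k \<le> 2 ^ (j - 2)" for k
    using that
  proof (induction k)
    case 0
    show ?case by (simp add: integrable_on_refl[of _ "0::real", simplified])
  next
    case (Suc k)
    obtain p :: "real poly" where
      p: "\<forall>x\<in>{real k / 2 ^ j<..<real (k + 1) / 2 ^ j}.
        d1 x = poly (pderiv p) x \<and> d2 x = poly (pderiv (pderiv p)) x"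
      using piece[of k] Suc.prems by auto
    \<comment> \<open>Changing the integrand at the two end knots, where \<open>d2\<close> may be
      unspecified, does not affect integrability.\<close>
    have "(\<lambda>x. d1 x ^ 4 + (d2 x)\<^sup>2) integrable_on cbox (real k / 2 ^ j) (real (k + 1) / 2 ^ j)"
    proof (rule integrable_spike_interior)
      show "(\<lambda>x. poly (pderiv p) x ^ 4 + (poly (pderiv (pderiv p)) x)\<^sup>2) integrable_on
          cbox (real k / 2 ^ j) (real (k + 1) / 2 ^ j)"
        by (intro integrable_continuous continuous_intros)
    qed (use p in auto)
    then have right: "(\<lambda>x. d1 x ^ 4 + (d2 x)\<^sup>2) integrable_on {real k / 2 ^ j..real (Suc k) / 2 ^ j}"
      by simp
    have left: "(\<lambda>x. d1 x ^ 4 + (d2 x)\<^sup>2) integrable_on {0..real k / 2 ^ j}"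
      using Suc by simp
    show ?case
      by (rule Henstock_Kurzweil_Integration.integrable_combine[OF _ _ left right]) (auto simp: divide_right_mono)
  qed
  from this[of "2 ^ (j - 2)"] show "(\<lambda>x. d1 x ^ 4 + (d2 x)\<^sup>2) integrable_on {0..1/4}"
    by (simp add: pow)
qed

section \<open>A single filter: range, quadrature identity and measurability\<close>

text \<open>One scale in isolation. Of the spline only two facts enter: continuity yields
  measurability, and the value at 1/4 yields the quadrature identity at that point.\<close>

locale angle_filter =
  fixes z m :: "real \<Rightarrow> real"
  assumes m_even: "m (- \<xi>) = m \<xi>"
    and m_periodic: "m (\<xi> + 1) = m \<xi>"
    and m_cos: "\<xi> \<in> {0..1/4} \<Longrightarrow> m \<xi> = cos (z \<xi>)"
    and m_sin: "\<xi> \<in> {1/4<..1/2} \<Longrightarrow> m \<xi> = sin (z (1/2 - \<xi>))"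
    and z_continuous: "continuous_on {0..1/4} z"
    and z_quarter: "z (1/4) = pi / 4"
begin

sublocale periodic_fun_simple' m
  by standard (rule m_periodic)

text \<open>The distance to the nearest integer. Evenness and periodicity reduce \<open>m\<close> to
  this argument in \<open>{0..1/2}\<close>, where the two defining formulas apply.\<close>

definition dist_int :: "real \<Rightarrow> real" where
  "dist_int \<xi> = \<bar>\<xi> - of_int (round \<xi>)\<bar>"

lemma dist_int_range: "dist_int \<xi> \<in> {0..1/2}"
  using of_int_round_abs_le[of \<xi>] by (simp add: dist_int_def abs_minus_commute)

lemma m_dist_int: "m (dist_int \<xi>) = m \<xi>"
  using minus_of_int[of \<xi> "round \<xi>"] m_even[of "\<xi> - of_int (round \<xi>)"]
  by (auto simp: dist_int_def abs_if)

lemma m_half_shift: "m (\<xi> + 1/2) = m (1/2 - dist_int \<xi>)"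
proof (cases "\<xi> \<ge> of_int (round \<xi>)")
  case True
  then have "m (\<xi> + 1/2) = m (dist_int \<xi> + 1/2 + of_int (round \<xi>))"
    by (simp add: dist_int_def)
  also have "\<dots> = m (1/2 - dist_int \<xi>)"
    \<comment> \<open>Evenness negates \<open>dist_int \<xi> + 1/2\<close>, and adding the period 1
      gives \<open>1/2 - dist_int \<xi>\<close>.\<close>
    unfolding plus_of_int
    using m_even[of "dist_int \<xi> + 1/2"] m_periodic[of "- (dist_int \<xi> + 1/2)"]
    by (simp add: algebra_simps)
  finally show ?thesis .
next
  case False
  then have "m (\<xi> + 1/2) = m (1/2 - dist_int \<xi> + of_int (round \<xi>))"
    by (simp add: dist_int_def add.commute)
  then show ?thesis by (simp only: plus_of_int)
qed

lemma abs_m_le_1: "\<bar>m \<xi>\<bar> \<le> 1"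
proof (cases "dist_int \<xi> \<le> 1/4")
  case True
  then show ?thesis using m_cos[of "dist_int \<xi>"] dist_int_range[of \<xi>] by (simp add: m_dist_int)
next
  case False
  then show ?thesis using m_sin[of "dist_int \<xi>"] dist_int_range[of \<xi>] by (simp add: m_dist_int)
qed

text \<open>The reflection of \<open>t\<close> to \<open>1/2 - t\<close> exchanges the cosine and
  sine branches with the same angle, except at \<open>t = 1/4\<close>: there both terms use the
  cosine branch, and the angle \<open>pi / 4\<close> makes each square 1/2.\<close>

lemma m_quadrature: "(m \<xi>)\<^sup>2 + (m (\<xi> + 1/2))\<^sup>2 = 1"
proof -
  define t where "t = dist_int \<xi>"
  have t: "0 \<le> t" "t \<le> 1/2" using dist_int_range[of \<xi>] by (auto simp: t_def)
  have "(m t)\<^sup>2 + (m (1/2 - t))\<^sup>2 = 1"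
  proof (cases t "1/4 :: real" rule: linorder_cases)
    case less
    then show ?thesis using t m_cos[of t] m_sin[of "1/2 - t"] by simp
  next
    case equal
    have "m (1/4) = cos (pi / 4)"
      using m_cos[of "1/4"] by (simp add: z_quarter)
    then have "(m (1/4))\<^sup>2 = 1/2" by (simp only: cos_45 power_divide) simp
    then show ?thesis by (simp add: equal)
  next
    case greater
    then show ?thesis using t m_sin[of t] m_cos[of "1/2 - t"] by simp
  qed
  then show ?thesis by (simp add: t_def m_dist_int m_half_shift)
qed

lemma borel_measurable_m [measurable]: "m \<in> borel_measurable borel"
proof -
  \<comment> \<open>Clamping the argument extends \<open>z\<close> continuously from
    \<open>{0..1/4}\<close> to the whole line, since nothing is known about \<open>z\<close>
    elsewhere.\<close>
  define zc where "zc t = z (max 0 (min (1/4) t))" for t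
  have "continuous_on UNIV zc"
    unfolding zc_def by (rule continuous_on_compose2[OF z_continuous]) (auto intro!: continuous_intros)
  then have [measurable]: "zc \<in> borel_measurable borel"
    by (rule borel_measurable_continuous_onI)
  have [measurable]: "dist_int \<in> borel_measurable borel"
    unfolding dist_int_def[abs_def] round_def by measurable
  have "m = (\<lambda>\<xi>. if dist_int \<xi> \<le> 1/4 then cos (zc (dist_int \<xi>)) else sin (zc (1/2 - dist_int \<xi>)))"
  proof
    fix \<xi>
    show "m \<xi> = (if dist_int \<xi> \<le> 1/4 then cos (zc (dist_int \<xi>)) else sin (zc (1/2 - dist_int \<xi>)))"
      using m_cos[of "dist_int \<xi>"] m_sin[of "dist_int \<xi>"] dist_int_range[of \<xi>]
      by (cases "dist_int \<xi> \<le> 1/4") (simp_all add: m_dist_int zc_def min_absorb2 max_absorb2)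
  qed
  then show ?thesis by simp
qed

end

section \<open>Uniform convergence of infinite products\<close>

text \<open>The partial products telescope, and since they are bounded by 1 their increments are
  dominated by \<open>M\<close>; the Weierstrass test applies.\<close>

lemma uniform_limit_prodinf:
  fixes f :: "nat \<Rightarrow> 'a \<Rightarrow> real"
  assumes f_le: "\<And>r x. x \<in> X \<Longrightarrow> \<bar>f r x\<bar> \<le> 1"
    and f_1: "\<And>r x. x \<in> X \<Longrightarrow> \<bar>f r x - 1\<bar> \<le> M r"
    and M: "summable M"
  shows "uniform_limit X (\<lambda>N x. \<Prod>r<N. f r x) (\<lambda>x. \<Prod>r. f r x) sequentially"
proof -
  define P where "P N x = (\<Prod>r<N. f r x)" for N x
  have "uniform_limit X (\<lambda>N x. \<Sum>n<N. P (Suc n) x - P n x) (\<lambda>x. \<Sum>n. P (Suc n) x - P n x) sequentially"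
  proof (rule Weierstrass_m_test[OF _ M])
    fix n x assume x: "x \<in> X"
    have "norm (P (Suc n) x - P n x) = \<bar>P n x\<bar> * \<bar>f n x - 1\<bar>"
      by (simp add: P_def algebra_simps flip: abs_mult)
    also have "\<dots> \<le> 1 * M n"
      unfolding P_def abs_prod using x f_le f_1 by (intro mult_mono prod_le_1) auto
    finally show "norm (P (Suc n) x - P n x) \<le> M n" by simp
  qed
  moreover have "(\<Sum>n<N. P (Suc n) x - P n x) = P N x - 1" for N x
    using sum_lessThan_telescope[of "\<lambda>n. P n x" N] by (simp add: P_def)
  ultimately have "uniform_limit X (\<lambda>N x. P N x - 1) (\<lambda>x. \<Sum>n. P (Suc n) x - P n x) sequentially"
    by simp
  from uniform_limit_add[OF this uniform_limit_const[of "\<lambda>x. 1" X]]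
  have *: "uniform_limit X P (\<lambda>x. (\<Sum>n. P (Suc n) x - P n x) + 1) sequentially"
    by simp
  have "(\<Sum>n. P (Suc n) x - P n x) + 1 = (\<Prod>r. f r x)" if x: "x \<in> X" for x
  proof -
    have "summable (\<lambda>r. norm (f r x - 1))"
      by (rule summable_comparison_test[OF _ M]) (use x f_1 in auto)
    \<comment> \<open>Individual factors may be zero: \<open>convergent_prod\<close> tolerates
      finitely many zeros, and the partial products still tend to the infinite product.\<close>
    then have "convergent_prod (\<lambda>r. f r x)"
      by (intro abs_convergent_prod_imp_convergent_prod summable_imp_abs_convergent_prod)
    then have "(\<lambda>N. P N x) \<longlonglongrightarrow> (\<Prod>r. f r x)"
      unfolding P_def LIMSEQ_lessThan_iff_atMost by (rule convergent_prod_LIMSEQ)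
    with tendsto_uniform_limitI[OF * x] show ?thesis by (rule LIMSEQ_unique)
  qed
  then have "uniform_limit X P (\<lambda>x. \<Prod>r. f r x) sequentially"
    using uniform_limit_cong'[THEN iffD1, OF refl _ *] by simp
  then show ?thesis by (simp only: P_def[abs_def])
qed

section \<open>The L2 bound for limits of quadrature products\<close>

text \<open>The interval of length \<open>2 ^ Suc N\<close> splits into halves differing by
  \<open>2 ^ N\<close>. This shift is a period of the first \<open>N\<close> factors and moves the
  argument of the new factor by 1/2, so \<open>quad\<close> removes that factor when the halves are
  added.\<close>

lemma nn_integral_quadrature_prod:
  fixes h :: "nat \<Rightarrow> real \<Rightarrow> real"
  assumes [measurable]: "\<And>r. h r \<in> borel_measurable borel"
    and nonneg: "\<And>r x. 0 \<le> h r x"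
    and per: "\<And>r x. h r (x + 1) = h r x"
    and quad: "\<And>r x. h r x + h r (x + 1/2) = 1"
  shows "(\<integral>\<^sup>+x. ennreal (\<Prod>r<N. h r (x / 2 ^ Suc r)) * indicator {a..<a + 2 ^ N} x \<partial>lborel) = 1"
proof (induction N)
  case 0
  then show ?case by simp
next
  case (Suc N)
  define P where "P x = (\<Prod>r<N. h r (x / 2 ^ Suc r))" for x
  define g where "g x = ennreal (P x * h N (x / 2 ^ Suc N))" for x
  have [measurable]: "P \<in> borel_measurable borel" unfolding P_def[abs_def] by measurable
  have P_nonneg: "0 \<le> P x" for x unfolding P_def by (intro prod_nonneg) (simp add: nonneg)
  have P_shift: "P (2 ^ N + x) = P x" for x
    unfolding P_def
  proof (rule prod.cong[OF refl])
    fix r assume "r \<in> {..<N}"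
    then have "(2 :: real) ^ N = 2 ^ Suc r * 2 ^ (N - Suc r)"
      by (simp flip: power_add power_Suc)
    then have *: "(2 ^ N + x) / 2 ^ Suc r = x / 2 ^ Suc r + real (2 ^ (N - Suc r))"
      by (simp add: field_simps)
    interpret periodic_fun_simple' "h r" by standard (rule per)
    have "h r (x / 2 ^ Suc r + real (2 ^ (N - Suc r))) = h r (x / 2 ^ Suc r)"
      by (rule plus_of_nat)
    with * show "h r ((2 ^ N + x) / 2 ^ Suc r) = h r (x / 2 ^ Suc r)"
      by (simp only:)
  qed
  have half: "(2 ^ N + x) / 2 ^ Suc N = x / 2 ^ Suc N + 1/2" for x :: real
    by (simp add: field_simps)
  have "(\<integral>\<^sup>+x. ennreal (\<Prod>r<Suc N. h r (x / 2 ^ Suc r)) * indicator {a..<a + 2 ^ Suc N} x \<partial>lborel)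
      = (\<integral>\<^sup>+x. g x * indicator {a..<a + 2 ^ N} x + g x * indicator {a + 2 ^ N..<a + 2 ^ Suc N} x \<partial>lborel)"
    by (intro nn_integral_cong) (auto simp: g_def P_def split: split_indicator)
  also have "\<dots> = (\<integral>\<^sup>+x. g x * indicator {a..<a + 2 ^ N} x \<partial>lborel)
      + (\<integral>\<^sup>+x. g x * indicator {a + 2 ^ N..<a + 2 ^ Suc N} x \<partial>lborel)"
    unfolding g_def by (rule nn_integral_add) measurable
  also have "(\<integral>\<^sup>+x. g x * indicator {a + 2 ^ N..<a + 2 ^ Suc N} x \<partial>lborel)
      = (\<integral>\<^sup>+x. g (2 ^ N + x) * indicator {a..<a + 2 ^ N} x \<partial>lborel)"
    unfolding g_def
    by (subst nn_integral_real_affine[where c = 1 and t = "2 ^ N"], measurable)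
      (auto intro!: nn_integral_cong split: split_indicator)
  also have "(\<integral>\<^sup>+x. g x * indicator {a..<a + 2 ^ N} x \<partial>lborel) + \<dots>
      = (\<integral>\<^sup>+x. g x * indicator {a..<a + 2 ^ N} x + g (2 ^ N + x) * indicator {a..<a + 2 ^ N} x \<partial>lborel)"
    unfolding g_def by (rule nn_integral_add[symmetric]) measurable
  also have "\<dots> = (\<integral>\<^sup>+x. ennreal (P x) * indicator {a..<a + 2 ^ N} x \<partial>lborel)"
  proof (intro nn_integral_cong)
    fix x
    have "g x + g (2 ^ N + x) = ennreal (P x * (h N (x / 2 ^ Suc N) + h N (x / 2 ^ Suc N + 1/2)))"
      unfolding g_def P_shift half
      by (simp add: P_nonneg nonneg distrib_left flip: ennreal_plus)
    then show "g x * indicator {a..<a + 2 ^ N} x + g (2 ^ N + x) * indicator {a..<a + 2 ^ N} x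
        = ennreal (P x) * indicator {a..<a + 2 ^ N} x"
      by (simp add: quad flip: distrib_right)
  qed
  also have "\<dots> = 1" using Suc by (simp add: P_def)
  finally show ?case .
qed

text \<open>The truncated squared products all have integral 1, but Fatou's lemma allows mass to be
  lost in the limit, hence the inequality.\<close>

lemma L2_norm_limit_of_products_le_1:
  fixes f :: "nat \<Rightarrow> real \<Rightarrow> real"
  assumes [measurable]: "\<And>r. f r \<in> borel_measurable borel"
    and per: "\<And>r x. f r (x + 1) = f r x"
    and quad: "\<And>r x. (f r x)\<^sup>2 + (f r (x + 1/2))\<^sup>2 = 1"
    and lim: "\<And>x. (\<lambda>N. \<Prod>r<N. f r (x / 2 ^ Suc r)) \<longlonglongrightarrow> g x"
  shows "square_integrable g" and "L2_norm g \<le> 1"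
proof -
  define u where "u N x = ennreal (\<Prod>r<N. (f r (x / 2 ^ Suc r))\<^sup>2) *
    indicator {- (2 ^ N / 2)..<- (2 ^ N / 2) + 2 ^ N} x" for N x
  have [measurable]: "g \<in> borel_measurable borel"
    by (rule borel_measurable_LIMSEQ_real[OF lim]) measurable
  have [measurable]: "u N \<in> borel_measurable lborel" for N
    unfolding u_def[abs_def] by measurable
  have u_lim: "(\<lambda>N. u N x) \<longlonglongrightarrow> ennreal ((g x)\<^sup>2)" for x
  proof -
    have "(\<lambda>N. ennreal (\<Prod>r<N. (f r (x / 2 ^ Suc r))\<^sup>2)) \<longlonglongrightarrow> ennreal ((g x)\<^sup>2)"
      using tendsto_power[OF lim, of x 2] by (intro tendsto_ennrealI) (simp add: prod_power_distrib)
    \<comment> \<open>Each fixed point eventually lies in the growing intervals, so the truncation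
      does not change the pointwise limit.\<close>
    moreover have "\<forall>\<^sub>F N in sequentially. ennreal (\<Prod>r<N. (f r (x / 2 ^ Suc r))\<^sup>2) = u N x"
    proof -
      obtain M where M: "2 * \<bar>x\<bar> < 2 ^ M"
        using real_arch_pow[of 2 "2 * \<bar>x\<bar>"] by auto
      show ?thesis
      proof (rule eventually_sequentiallyI[of M])
        fix N assume "M \<le> N"
        then have "(2::real) ^ M \<le> 2 ^ N" by simp
        with M have "2 * \<bar>x\<bar> < 2 ^ N" by linarith
        then have "x \<in> {- (2 ^ N / 2)..<- (2 ^ N / 2) + 2 ^ N}" by auto
        then show "ennreal (\<Prod>r<N. (f r (x / 2 ^ Suc r))\<^sup>2) = u N x" by (simp add: u_def)
      qed
    qed
    ultimately show ?thesis by (rule Lim_transform_eventually)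
  qed
  have "(\<integral>\<^sup>+x. ennreal ((g x)\<^sup>2) \<partial>lborel) = (\<integral>\<^sup>+x. liminf (\<lambda>N. u N x) \<partial>lborel)"
    by (intro nn_integral_cong) (simp add: lim_imp_Liminf[OF _ u_lim])
  also have "\<dots> \<le> liminf (\<lambda>N. integral\<^sup>N lborel (u N))"
    by (rule nn_integral_liminf) measurable
  also have "(\<lambda>N. integral\<^sup>N lborel (u N)) = (\<lambda>N. 1)"
    unfolding u_def
    by (intro ext nn_integral_quadrature_prod[where h = "\<lambda>r x. (f r x)\<^sup>2"]) (auto simp: per quad)
  finally have le: "(\<integral>\<^sup>+x. ennreal ((g x)\<^sup>2) \<partial>lborel) \<le> 1"
    by (simp add: Liminf_const)
  then have int: "integrable lborel (\<lambda>x. (g x)\<^sup>2)"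
    by (intro integrableI_nonneg) (auto intro: le_less_trans)
  then show "square_integrable g" by (simp add: square_integrable_def)
  have "ennreal (\<integral>x. (g x)\<^sup>2 \<partial>lborel) \<le> 1"
    using le nn_integral_eq_integral[OF int] by simp
  then show "L2_norm g \<le> 1" by (simp add: L2_norm_def)
qed

section \<open>Assembly for the spline filters\<close>

theorem lemma3:
  fixes K :: nat
    and \<nu> \<theta> :: "nat \<Rightarrow> int \<Rightarrow> real"
    and z m \<phi> :: "nat \<Rightarrow> real \<Rightarrow> real"
  assumes K: "K \<ge> 2"
    and nu_nonneg: "\<And>j k. j \<ge> 2 \<Longrightarrow> \<nu> j k \<ge> 0"
    and nu_periodic: "\<And>j k. j \<ge> 2 \<Longrightarrow> \<nu> j k = \<nu> j (k + 2 ^ j)"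
    and nu_quad: "\<And>j k. j \<ge> 2 \<Longrightarrow> \<bar>\<nu> j k\<bar>\<^sup>2 + \<bar>\<nu> j (k + 2 ^ (j - 1))\<bar>\<^sup>2 = 1"
    and nu_even: "\<And>j k. j \<ge> 2 \<Longrightarrow> \<nu> j k = \<nu> j (- k)"
    and nu_0: "\<And>j. j \<ge> 2 \<Longrightarrow> \<nu> j 0 = 1"
    and theta: "\<And>j k. j \<ge> 2 \<Longrightarrow> \<theta> j k = arccos (\<nu> j k)"
    and z_spline: "\<And>j. j \<ge> 2 \<Longrightarrow> uniform_spline K j (z j)"
    and z_interp: "\<And>j k. j \<ge> 2 \<Longrightarrow> k \<le> 2 ^ (j - 2) \<Longrightarrow> z j (real k / 2 ^ j) = \<theta> j (int k)"
    and z_boundary: "\<And>j l. j \<ge> 2 \<Longrightarrow> 1 \<le> l \<Longrightarrow> l \<le> K - 1 \<Longrightarrow> nderiv_within {0..1/4} l (z j) 0 = 0"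
    and m_even: "\<And>j \<xi>. j \<ge> 2 \<Longrightarrow> m j (- \<xi>) = m j \<xi>"
    and m_periodic: "\<And>j \<xi>. j \<ge> 2 \<Longrightarrow> m j (\<xi> + 1) = m j \<xi>"
    and m_cos: "\<And>j \<xi>. j \<ge> 2 \<Longrightarrow> \<xi> \<in> {0..1/4} \<Longrightarrow> m j \<xi> = cos (z j \<xi>)"
    and m_sin: "\<And>j \<xi>. j \<ge> 2 \<Longrightarrow> \<xi> \<in> {1/4<..1/2} \<Longrightarrow> m j \<xi> = sin (z j (1/2 - \<xi>))"
    and phi: "\<And>j \<xi>. j \<ge> 1 \<Longrightarrow> \<phi> j \<xi> = (\<Prod>r. m (j + Suc r) (\<xi> / 2 ^ Suc r))"
    and sum_finite: "summable (\<lambda>i. let j = i + 2 in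
          1 / 2 ^ j * sqrt (integral {0..1/4} (\<lambda>\<xi>.
            (nderiv_within {0..1/4} 1 (z j) \<xi>) ^ 4 + (nderiv_within {0..1/4} 2 (z j) \<xi>) ^ 2)))"
  shows "\<forall>j\<ge>1.
     (\<forall>a b.
        uniform_limit {a..b} (\<lambda>N \<xi>. \<Prod>r=1..N. m (j + r) (\<xi> / 2 ^ r)) (\<phi> j) sequentially \<and>
        uniformly_convergent_on {a..b} (\<lambda>N \<xi>. \<Sum>r=1..N. \<bar>m (j + r) (\<xi> / 2 ^ r) - 1\<bar>)) \<and>
     square_integrable (\<phi> j) \<and> L2_norm (\<phi> j) \<le> 1"
proof -
  define E where "E j = integral {0..1/4} (\<lambda>\<xi>.
    (nderiv_within {0..1/4} 1 (z j) \<xi>) ^ 4 + (nderiv_within {0..1/4} 2 (z j) \<xi>)\<^sup>2)" for j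
  \<comment> \<open>The summand 1 keeps the AM-GM parameter positive when \<open>E j = 0\<close>; the factor 8 makes the bound
    trivial for \<open>\<bar>\<xi>\<bar> > 1/4\<close>.\<close>
  define C where "C j = 8 * (1 + sqrt (E j))" for j
  have z_0: "z j 0 = 0" if "j \<ge> 2" for j
    using z_interp[of j 0] theta[of j 0] nu_0[of j] that by simp
  have z_quarter: "z j (1/4) = pi / 4" if j: "j \<ge> 2" for j
  proof -
    let ?k = "2 ^ (j - 2) :: int"
    have pow: "(2::int) ^ j = 4 * ?k" "(2::int) ^ (j - 1) = 2 * ?k" "(2::real) ^ j = 4 * 2 ^ (j - 2)"
      using j by (auto simp: numeral_2_eq_2 le_iff_add power_add)
    \<comment> \<open>Since \<open>?k + 2 ^ (j - 1) = - ?k + 2 ^ j\<close>, periodicity and evenness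
      make both terms of the quadrature condition at \<open>?k\<close> equal, so each is
      1/2.\<close>
    have "\<nu> j (?k + 2 ^ (j - 1)) = \<nu> j (- ?k + 2 ^ j)"
      by (simp only: pow) simp
    also have "\<dots> = \<nu> j ?k"
      using nu_periodic[OF j, of "- ?k"] nu_even[OF j, of ?k] by simp
    finally have "(\<nu> j ?k)\<^sup>2 = 1 / 2"
      using nu_quad[OF j, of ?k] by simp
    then have "\<nu> j ?k = sqrt (1 / 2)"
      using nu_nonneg[OF j, of ?k] by (metis real_sqrt_unique)
    also have "\<dots> = cos (pi / 4)"
      by (simp add: cos_45 real_sqrt_divide field_simps)
    finally have "\<theta> j ?k = pi / 4"
      using theta[OF j, of ?k] by (simp add: arccos_cos)
    then show ?thesis
      using z_interp[OF j, of "2 ^ (j - 2)"] by (simp add: pow(3))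
  qed
  have filter: "angle_filter (z j) (m j)" if j: "j \<ge> 2" for j
  proof
    show "continuous_on {0..1/4} (z j)"
      using uniform_spline_has_derivative[OF K j z_spline[OF j]] by (rule DERIV_continuous_on)
  qed (use j m_even m_periodic m_cos m_sin z_quarter in auto)
  have dev: "\<bar>m j \<xi> - 1\<bar> \<le> C j * \<bar>\<xi>\<bar>" if j: "j \<ge> 2" for j \<xi>
  proof -
    interpret angle_filter "z j" "m j" using filter[OF j] .
    note spl = K j z_spline[OF j]
    define s where "s = 1 + sqrt (E j)"
    have "0 \<le> E j" unfolding E_def
      by (rule integral_nonneg[OF uniform_spline_energy_integrable[OF spl]]) auto
    then have s: "1 \<le> s" and E: "E j \<le> s\<^sup>2"
      by (auto simp: s_def power2_sum)
    have C: "C j = 8 * s" by (simp add: C_def s_def)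
    show ?thesis
    proof (cases "\<bar>\<xi>\<bar> \<le> 1/4")
      case True
      have "m j \<xi> = m j \<bar>\<xi>\<bar>"
        using m_even[of \<xi>] by (cases "0 \<le> \<xi>") simp_all
      also have "\<dots> = cos (z j \<bar>\<xi>\<bar>)"
        using True by (intro m_cos) simp
      finally have "\<bar>m j \<xi> - 1\<bar> = \<bar>cos (z j \<bar>\<xi>\<bar>) - 1\<bar>" by simp
      also have "\<dots> \<le> (E j / s + 2 * (1/4) * s) / 2 * \<bar>\<xi>\<bar>"
        unfolding E_def
      proof (rule cos_deviation_bound[OF _ z_0[OF j] uniform_spline_has_derivative[OF spl]
            uniform_spline_continuous_derivative[OF spl] uniform_spline_second_derivative[OF spl]
            uniform_spline_energy_integrable[OF spl]])
        show "\<bar>\<xi>\<bar> \<in> {0..1/4}" using True by simp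
      qed (use s in simp_all)
      also have "\<dots> \<le> 8 * s * \<bar>\<xi>\<bar>"
      proof (rule mult_right_mono)
        have "E j / s \<le> s" using s E by (simp add: divide_le_eq power2_eq_square)
        then show "(E j / s + 2 * (1/4) * s) / 2 \<le> 8 * s" using s by simp
      qed simp
      finally show ?thesis by (simp add: C)
    next
      case False
      have "\<bar>m j \<xi> - 1\<bar> \<le> 2" using abs_m_le_1[of \<xi>] by linarith
      also have "\<dots> \<le> 8 * 1 * \<bar>\<xi>\<bar>" using False by simp
      also have "\<dots> \<le> C j * \<bar>\<xi>\<bar>"
        unfolding C using s by (intro mult_right_mono) auto
      finally show ?thesis .
    qed
  qed
  \<comment> \<open>The constant 1 in \<open>C\<close> contributes a geometric series and the root
    of \<open>E\<close> the series of the hypothesis; both start at scale 2.\<close>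
  have "summable (\<lambda>i. 8 * ((1/2) ^ (i + 2) + 1 / 2 ^ (i + 2) * sqrt (E (i + 2))))"
    using sum_finite summable_ignore_initial_segment[OF summable_geometric[of "1/2 :: real"], of 2]
    by (intro summable_mult summable_add) (simp_all add: Let_def E_def)
  also have "(\<lambda>i. 8 * ((1/2) ^ (i + 2) + 1 / 2 ^ (i + 2) * sqrt (E (i + 2))))
      = (\<lambda>i. C (i + 2) / 2 ^ (i + 2))"
    by (auto simp: C_def field_simps)
  finally have C_summable: "summable (\<lambda>j. C j / 2 ^ j)"
    by (rule summable_iff_shift[THEN iffD1])
  show ?thesis
  proof (intro allI impI)
    fix j :: nat assume j: "j \<ge> 1"
    define f where "f r = m (j + Suc r)" for r
    have filter_f: "angle_filter (z (j + Suc r)) (f r)" for r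
      unfolding f_def using j by (intro filter) auto
    have phi_f: "\<phi> j = (\<lambda>\<xi>. \<Prod>r. f r (\<xi> / 2 ^ Suc r))"
      using phi[OF j] by (auto simp: f_def)
    have prod_f: "(\<Prod>r=1..N. m (j + r) (\<xi> / 2 ^ r)) = (\<Prod>r<N. f r (\<xi> / 2 ^ Suc r))"
      and sum_f: "(\<Sum>r=1..N. \<bar>m (j + r) (\<xi> / 2 ^ r) - 1\<bar>) = (\<Sum>r<N. \<bar>f r (\<xi> / 2 ^ Suc r) - 1\<bar>)"
      for N \<xi>
      by (simp_all add: f_def prod.atLeast1_atMost_eq sum.atLeast1_atMost_eq)
    \<comment> \<open>The factor \<open>2 ^ j\<close> rescales \<open>2 ^ (r + Suc j)\<close> to
      \<open>2 ^ Suc r\<close>, so that \<open>M R\<close> is a multiple of a tail of the summable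
      series of \<open>C j / 2 ^ j\<close>.\<close>
    define M where "M R r = R * 2 ^ j * (C (r + Suc j) / 2 ^ (r + Suc j))" for R :: real and r
    have M_summable: "summable (M R)" for R
      unfolding M_def[abs_def] by (intro summable_mult summable_ignore_initial_segment C_summable)
    have M: "\<bar>f r (\<xi> / 2 ^ Suc r) - 1\<bar> \<le> M R r" if "\<bar>\<xi>\<bar> \<le> R" for r \<xi> R
    proof -
      \<comment> \<open>The deviation bound at the point 1 forces the constant to be
        nonnegative.\<close>
      have C0: "0 \<le> C (j + Suc r)"
        using order_trans[OF abs_ge_zero dev[of "j + Suc r" 1]] j by simp
      have "\<bar>f r (\<xi> / 2 ^ Suc r) - 1\<bar> \<le> C (j + Suc r) * \<bar>\<xi> / 2 ^ Suc r\<bar>"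
        unfolding f_def using j by (intro dev) auto
      also have "\<dots> \<le> C (j + Suc r) * (R / 2 ^ Suc r)"
        using that C0 by (intro mult_left_mono) (auto simp: abs_divide divide_right_mono)
      also have "\<dots> = M R r"
        by (simp add: M_def power_add add.commute field_simps)
      finally show ?thesis .
    qed
    have f_le: "\<bar>f r \<xi>\<bar> \<le> 1" for r \<xi>
      using angle_filter.abs_m_le_1[OF filter_f] .
    have unif: "uniform_limit X (\<lambda>N \<xi>. \<Prod>r<N. f r (\<xi> / 2 ^ Suc r)) (\<phi> j) sequentially"
      if "\<And>\<xi>. \<xi> \<in> X \<Longrightarrow> \<bar>\<xi>\<bar> \<le> R" for X R
      unfolding phi_f by (rule uniform_limit_prodinf[OF f_le M[OF that] M_summable])
    have Icc: "\<bar>\<xi>\<bar> \<le> max \<bar>a\<bar> \<bar>b\<bar>" if "\<xi> \<in> {a..b}" for a b \<xi> :: real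
      using that by auto
    have lim: "(\<lambda>N. \<Prod>r<N. f r (\<xi> / 2 ^ Suc r)) \<longlonglongrightarrow> \<phi> j \<xi>" for \<xi>
      by (rule tendsto_uniform_limitI[OF unif[of "{\<xi>}" "\<bar>\<xi>\<bar>"]]) auto
    note L2 = L2_norm_limit_of_products_le_1[OF angle_filter.borel_measurable_m[OF filter_f]
        angle_filter.m_periodic[OF filter_f] angle_filter.m_quadrature[OF filter_f] lim]
    have "uniform_limit {a..b} (\<lambda>N \<xi>. \<Prod>r=1..N. m (j + r) (\<xi> / 2 ^ r)) (\<phi> j) sequentially \<and>
        uniformly_convergent_on {a..b} (\<lambda>N \<xi>. \<Sum>r=1..N. \<bar>m (j + r) (\<xi> / 2 ^ r) - 1\<bar>)" for a b
      unfolding prod_f sum_f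
    proof
      show "uniform_limit {a..b} (\<lambda>N \<xi>. \<Prod>r<N. f r (\<xi> / 2 ^ Suc r)) (\<phi> j) sequentially"
        using Icc by (rule unif)
      show "uniformly_convergent_on {a..b} (\<lambda>N \<xi>. \<Sum>r<N. \<bar>f r (\<xi> / 2 ^ Suc r) - 1\<bar>)"
      proof (rule Weierstrass_m_test'[OF _ M_summable])
        show "norm \<bar>f r (\<xi> / 2 ^ Suc r) - 1\<bar> \<le> M (max \<bar>a\<bar> \<bar>b\<bar>) r" if "\<xi> \<in> {a..b}" for r \<xi>
          using M[OF Icc[OF that]] by simp
      qed
    qed
    with L2 show "(\<forall>a b.
        uniform_limit {a..b} (\<lambda>N \<xi>. \<Prod>r=1..N. m (j + r) (\<xi> / 2 ^ r)) (\<phi> j) sequentially \<and>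
        uniformly_convergent_on {a..b} (\<lambda>N \<xi>. \<Sum>r=1..N. \<bar>m (j + r) (\<xi> / 2 ^ r) - 1\<bar>)) \<and>
      square_integrable (\<phi> j) \<and> L2_norm (\<phi> j) \<le> 1"
      by blast
  qed
qed

end
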